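(* Let $\boldsymbol{t}=\{t_k\}_{k\geq1}\subset[0,\frac{\pi}{4}]$ be a sequence (strictly) decreasing to $0$ and let $\boldsymbol{e}=\{e_k\}_{k\geq1}\subset(0,1]$ be any sequence. For each $k\geq1$ let $R_k\subset\mathbb{R}^2$ be a rectangle with eccentricity and orientation $(e_{R_k},\omega_{R_k})=(e_k,t_k)$, and let $\mathcal{B}=\{R_k\}_{k\geq1}$. Put $$\tau_{\boldsymbol{t}}:=\sup_{k\geq1,\ 1\leq l\leq k}\left(\frac{t_{k+2l}-t_{k+l}}{t_{k+l}-t_k}+\frac{t_{k+l}-t_k}{t_{k+2l}-t_{k+l}}\right)\in(0,\infty].$$ Suppose that $\tau_{\boldsymbol{t}}<\infty$ and that there is a constant $\mu_0>0$ such that $e_k<\mu_0|t_k-t_{k+1}|$ for every $k\geq1$. Then the geometric maximal operator $M_{\mathcal{B}}$ is a bad operator, i.e. it is unbounded on $L^p(\mathbb{R}^2)$ for every $1<p<\infty$.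
   Context: $|A|$ denotes the Lebesgue measure of a measurable set $A\subset\mathbb{R}^2$. For a (nondegenerate) rectangle $R\subset\mathbb{R}^2$, its orientation $\omega_R\in[0,\pi)$ is the angle its longest side makes with the $Ox$-axis (for a square either side direction may be taken as the longest one), and its eccentricity $e_R\in(0,1]$ is the ratio of its shortest side to its longest side. For a non-empty family $\mathcal{B}$ of rectangles, set $$\mathcal{B}^*=\{\vec t+hR:\ \vec t\in\mathbb{R}^2,\ h>0,\ R\in\mathcal{B}\},$$ and define the geometric maximal operator generated by $\mathcal{B}$ by $$M_{\mathcal{B}}f(x)=\sup_{x\in R\in\mathcal{B}^*}\frac{1}{|R|}\int_R|f|,\qquad f\in L^1_{loc}(\mathbb{R}^2),\ x\in\mathbb{R}^2.$$ For $p\in(1,\infty]$ let $\|M_{\mathcal{B}}\|_p=\sup_{\|f\|_p=1}\|M_{\mathcal{B}}f\|_p$; $M_{\mathcal{B}}$ is unbounded on $L^p(\mathbb{R}^2)$ if $\|M_{\mathcal{B}}\|_p=\infty$. *)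

theory Defs
  imports "HOL-Analysis.Analysis"
begin

text \<open>
  The nondegenerate closed rectangle with a vertex at \<open>c\<close>, one side of length \<open>a\<close> making the
  angle \<open>\<theta>\<close> with the first coordinate axis, and the other side of length \<open>b\<close>.
\<close>

definition rectangle :: "real^2 \<Rightarrow> real \<Rightarrow> real \<Rightarrow> real \<Rightarrow> (real^2) set" where
  "rectangle c \<theta> a b =
     {c + s *\<^sub>R vector [cos \<theta>, sin \<theta>] + r *\<^sub>R vector [- sin \<theta>, cos \<theta>] | s r.
        0 \<le> s \<and> s \<le> a \<and> 0 \<le> r \<and> r \<le> b}"

text \<open>
  A relation rather than a pair of functions, because a square has two orientations: either
  side direction may be taken as the longest one (the case \<open>a = b\<close>).
\<close>

definition rectangle_with_ecc_orient :: "(real^2) set \<Rightarrow> real \<Rightarrow> real \<Rightarrow> bool" where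
  "rectangle_with_ecc_orient R e \<omega> \<longleftrightarrow>
     (\<exists>c a b. 0 < b \<and> b \<le> a \<and> 0 \<le> \<omega> \<and> \<omega> < pi \<and> R = rectangle c \<omega> a b \<and> e = b / a)"

definition dilates :: "(real^2) set set \<Rightarrow> (real^2) set set" where
  "dilates \<B> = {(\<lambda>y. t + h *\<^sub>R y) ` R | t h R. 0 < h \<and> R \<in> \<B>}"

definition geometric_maximal ::
  "(real^2) set set \<Rightarrow> (real^2 \<Rightarrow> real) \<Rightarrow> real^2 \<Rightarrow> ennreal" where
  "geometric_maximal \<B> f x =
     (SUP R \<in> {R \<in> dilates \<B>. x \<in> R}.
        (\<integral>\<^sup>+ y \<in> R. ennreal \<bar>f y\<bar> \<partial>lebesgue) / emeasure lebesgue R)"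

definition ennreal_powr :: "ennreal \<Rightarrow> real \<Rightarrow> ennreal" where
  "ennreal_powr x p = (if x = \<infinity> then \<infinity> else ennreal (enn2real x powr p))"

text \<open>
  The \<open>L\<^sup>p\<close> norm, for finite \<open>p\<close>, of a function with values in \<open>[0, \<infinity>]\<close>.
\<close>

definition Lp_norm :: "real \<Rightarrow> (real^2 \<Rightarrow> ennreal) \<Rightarrow> ennreal" where
  "Lp_norm p g = ennreal_powr (\<integral>\<^sup>+ x. ennreal_powr (g x) p \<partial>lebesgue) (1 / p)"

text \<open>
  A measurable function with finite \<open>L\<^sup>p\<close> norm, \<open>p \<ge> 1\<close>, is locally integrable, so that the maximal
  operator applies to it. For a family of nondegenerate closed rectangles its image is lower
  semicontinuous, hence measurable.
\<close>

definition maximal_norm :: "(real^2) set set \<Rightarrow> real \<Rightarrow> ennreal" where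
  "maximal_norm \<B> p =
     (SUP f \<in> {f \<in> borel_measurable lebesgue. Lp_norm p (\<lambda>x. ennreal \<bar>f x\<bar>) = 1}.
        Lp_norm p (geometric_maximal \<B> f))"

definition bad_operator :: "(real^2) set set \<Rightarrow> bool" where
  "bad_operator \<B> \<longleftrightarrow> (\<forall>p>1. maximal_norm \<B> p = \<infinity>)"

definition tau :: "(nat \<Rightarrow> real) \<Rightarrow> ereal" where
  "tau t =
     (SUP k \<in> {1..}. SUP l \<in> {1..k}.
        ereal ((t (k + 2 * l) - t (k + l)) / (t (k + l) - t k)
             + (t (k + l) - t k) / (t (k + 2 * l) - t (k + l))))"

end

theory Submission
  imports Defs
begin

text \<open>
  Instead of cutting and shifting triangles, the Perron tree is replaced by an explicit family of
  tubes. Put \<open>N = 2\<^sup>m\<close> and \<open>s\<^sub>j = tan t\<^bsub>N+j\<^esub>\<close> for \<open>0 \<le> j \<le> N\<close>, and let \<open>u\<^sub>q(j)\<close> be the slope at the left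
  end of the dyadic block of length \<open>2\<^sup>q\<close> containing \<open>j\<close>. The line of slope \<open>s\<^sub>j\<close> gets the intercept
  \<open>(2/m) \<Sum>\<^sub>q (u\<^sub>q(j) - s\<^sub>j)\<close>, so that its height over \<open>x\<close> is \<open>(x - 2) s\<^sub>j + (2/m) \<Sum>\<^sub>q u\<^sub>q(j)\<close>, and is thickened
  to a tube of width proportional to \<open>s\<^sub>j - s\<^bsub>j+1\<^esub>\<close>.

  Over \<open>x \<ge> 3\<close> the height decreases in \<open>j\<close> at least as fast as \<open>s\<^sub>j\<close>, so the tubes are disjoint and
  have total width \<open>S = s\<^sub>0 - s\<^sub>N\<close>. Over \<open>0 \<le> x \<le> 1\<close> there is a level \<open>Q \<approx> m (2 - x) / 2\<close> at which the
  contribution \<open>(x - 2) s\<^sub>j\<close> is cancelled by the levels below \<open>Q\<close> up to \<open>O(1/m)\<close>. Finiteness of \<open>\<tau>\<close>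
  makes block lengths shrink geometrically, so all lines of a block of level \<open>Q\<close> stay within
  \<open>O(1/m)\<close> times the slope difference across it, and the tubes cover only \<open>o(1) S\<close>. A rectangle of
  orientation \<open>t\<^sub>k\<close> reaching back from a point of the far part of a tube meets the near part in a
  fixed proportion, because \<open>e\<^sub>k\<close> is at most a multiple of the tube width. Testing the operator on
  the indicator of the near parts gives norms at least \<open>c (1 / o(1))\<^bsup>1/p\<^esup>\<close>.
\<close>

subsection \<open>Sheared rectangles in the plane\<close>

lemma measurable_vec2: "(\<lambda>(x, y). vector [x, y] :: real^2) \<in> borel_measurable borel"
proof -
  have "(\<lambda>(x, y). vector [x, y] :: real^2) = (\<lambda>z. fst z *\<^sub>R axis 1 1 + snd z *\<^sub>R axis 2 1)"
    by (auto simp: fun_eq_iff vec_eq_iff forall_2 axis_def)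
  then show ?thesis
    by (simp add: borel_measurable_continuous_onI continuous_intros)
qed

lemma lborel_Times:
  fixes A B :: "real set"
  assumes "A \<in> sets borel" "B \<in> sets borel"
  shows "emeasure lborel (A \<times> B) = emeasure lborel A * emeasure lborel B"
  using assms by (simp add: lborel_prod[symmetric] lborel.emeasure_pair_measure_Times)

text \<open>Agreement on open boxes determines Lebesgue measure. This makes Tonelli available on
  \<open>real^2\<close>.\<close>

lemma lborel_vec2:
  "lborel = distr (lborel :: (real \<times> real) measure) borel (\<lambda>(x, y). vector [x, y] :: real^2)"
proof (rule lborel_eqI)
  show "sets (distr (lborel :: (real \<times> real) measure) borel (\<lambda>(x, y). vector [x, y] :: real^2)) = sets borel"
    by simp
  fix l u :: "real^2"
  assume le: "\<And>b. b \<in> Basis \<Longrightarrow> l \<bullet> b \<le> u \<bullet> b"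
  have vb: "(\<lambda>(x, y). vector [x, y] :: real^2) -` box l u = {l$1<..<u$1} \<times> {l$2<..<u$2}"
    by (auto simp: mem_box_cart forall_2)
  have Basis: "(Basis :: (real^2) set) = {axis 1 1, axis 2 1}"
    by (auto simp: Basis_vec_def exhaust_2 UNIV_2)
  have ne: "axis 1 1 \<noteq> (axis 2 1 :: real^2)"
    by (simp add: axis_eq_axis)
  have "l$1 \<le> u$1" "l$2 \<le> u$2"
    using le[of "axis 1 1"] le[of "axis 2 1"] by (auto simp: Basis inner_axis)
  then show "emeasure (distr (lborel :: (real \<times> real) measure) borel (\<lambda>(x, y). vector [x, y] :: real^2)) (box l u) = (\<Prod>b\<in>Basis. (u - l) \<bullet> b)"
    using ne by (subst emeasure_distr)
      (auto simp: measurable_vec2 vb Basis inner_axis lborel_Times ennreal_mult)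
qed

text \<open>Tonelli over vertical sections: the near tubes have to be measured section by section,
  because the level suited to them varies with x.\<close>

lemma emeasure_vec2:
  assumes "A \<in> sets (borel :: (real^2) measure)"
  shows "emeasure lebesgue A = (\<integral>\<^sup>+ x. emeasure lborel {y. vector [x, y] \<in> A} \<partial>lborel)"
proof -
  let ?v = "\<lambda>(x, y). vector [x, y] :: real^2"
  have meas: "?v \<in> lborel \<Otimes>\<^sub>M lborel \<rightarrow>\<^sub>M borel"
    using measurable_vec2 by (simp add: lborel_prod)
  have "emeasure lebesgue A = emeasure (distr (lborel \<Otimes>\<^sub>M lborel) borel ?v) A"
    using assms lborel_vec2 by (simp add: lborel_prod)
  also have "\<dots> = emeasure (lborel \<Otimes>\<^sub>M lborel) (?v -` A \<inter> space (lborel \<Otimes>\<^sub>M lborel))"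
    by (intro emeasure_distr meas assms)
  also have "\<dots> = (\<integral>\<^sup>+ x. emeasure lborel (Pair x -` (?v -` A \<inter> space (lborel \<Otimes>\<^sub>M lborel))) \<partial>lborel)"
    by (intro lborel.emeasure_pair_measure_alt measurable_sets[OF meas] assms)
  finally show ?thesis
    by (simp add: vimage_def space_pair_measure)
qed

text \<open>The image of A x B under the shear (x, y) -> (x, y + s x), a bundle of parallel segments
  of slope s with intercepts in B.\<close>

definition strip :: "real \<Rightarrow> real set \<Rightarrow> real set \<Rightarrow> (real^2) set" where
  "strip s A B = {z. z$1 \<in> A \<and> z$2 - s * z$1 \<in> B}"

lemma strip_borel:
  assumes "A \<in> sets borel" "B \<in> sets borel"
  shows "strip s A B \<in> sets borel"
proof -
  have "(\<lambda>z::real^2. z$1) -` A \<inter> space borel \<in> sets borel"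
    "(\<lambda>z::real^2. z$2 - s * z$1) -` B \<inter> space borel \<in> sets borel"
    by (rule measurable_sets[OF _ assms(1)] measurable_sets[OF _ assms(2)];
      intro borel_measurable_continuous_onI continuous_intros)+
  moreover have "strip s A B = ((\<lambda>z. z$1) -` A \<inter> space borel) \<inter> ((\<lambda>z. z$2 - s * z$1) -` B \<inter> space borel)"
    by (auto simp: strip_def)
  ultimately show ?thesis by simp
qed

text \<open>Shears preserve area: every section over A is a translate of B.\<close>

lemma emeasure_strip:
  assumes "A \<in> sets borel" "B \<in> sets borel"
  shows "emeasure lebesgue (strip s A B) = emeasure lborel A * emeasure lborel B"
proof -
  have sec: "emeasure lborel {y. vector [x, y] \<in> strip s A B} = emeasure lborel B * indicator A x"
    for x
  proof (cases "x \<in> A")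
    case True
    have "emeasure lborel B = emeasure (distr lborel borel ((+) (- (s * x)))) B"
      by (simp add: lborel_distr_plus)
    also have "\<dots> = emeasure lborel ((+) (- (s * x)) -` B \<inter> space lborel)"
      using assms by (intro emeasure_distr) auto
    also have "(+) (- (s * x)) -` B \<inter> space lborel = {y. vector [x, y] \<in> strip s A B}"
      using True by (auto simp: strip_def)
    finally show ?thesis using True by simp
  qed (auto simp: strip_def)
  show ?thesis
    unfolding emeasure_vec2[OF strip_borel[OF assms]] sec
    using assms by (simp add: nn_integral_cmult_indicator mult.commute[of "emeasure lborel A"])
qed

subsection \<open>Tubes with dyadically chosen intercepts\<close>

text \<open>In \<open>halving\<close>, \<open>p div 2\<close> indexes the parent of block p of level
  q, so each half carries at most the fraction \<theta> of its parent's slope drop.\<close>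

locale dyadic_slopes =
  fixes s :: "nat \<Rightarrow> real" and m :: nat and \<theta> :: real
  assumes m_pos: "0 < m"
    and theta: "0 \<le> \<theta>" "\<theta> < 1"
    and antimono: "\<And>i j. i \<le> j \<Longrightarrow> j \<le> 2 ^ m \<Longrightarrow> s j \<le> s i"
    and halving: "\<And>q p. q < m \<Longrightarrow> p < 2 ^ (m - q) \<Longrightarrow>
      s (p * 2 ^ q) - s (Suc p * 2 ^ q) \<le>
      \<theta> * (s (p div 2 * 2 ^ Suc q) - s (Suc (p div 2) * 2 ^ Suc q))"
begin

definition \<Delta> :: "nat \<Rightarrow> nat \<Rightarrow> real" where
  "\<Delta> q p = s (p * 2 ^ q) - s (Suc p * 2 ^ q)"

definition anc :: "nat \<Rightarrow> nat \<Rightarrow> nat" where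
  "anc q j = j div 2 ^ q * 2 ^ q"

definition icpt :: "nat \<Rightarrow> real" where
  "icpt j = 2 / m * (\<Sum>q = 1..m. s (anc q j) - s j)"

lemma anc_le: "anc q j \<le> j"
  by (simp add: anc_def)

lemma anc_mono: "i \<le> j \<Longrightarrow> anc q i \<le> anc q j"
  by (simp add: anc_def div_le_mono)

lemma block_less:
  assumes "j < 2 ^ m" "q \<le> m"
  shows "j div 2 ^ q < (2 :: nat) ^ (m - q)"
  using assms by (simp add: div_less_iff_less_mult flip: power_add)

lemma block_end:
  assumes "p < 2 ^ (m - q)" "q \<le> m"
  shows "Suc p * 2 ^ q \<le> 2 ^ m"
proof -
  have "Suc p * 2 ^ q \<le> 2 ^ (m - q) * 2 ^ q"
    using assms by (intro mult_right_mono) auto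
  then show ?thesis using assms by (simp flip: power_add)
qed

lemma \<Delta>_nonneg:
  assumes "p < 2 ^ (m - q)" "q \<le> m"
  shows "0 \<le> \<Delta> q p"
  using antimono[OF _ block_end[OF assms], of "p * 2 ^ q"] by (simp add: \<Delta>_def)

text \<open>Iterates \<open>halving\<close> along the chain of blocks containing j.\<close>

lemma \<Delta>_decay:
  assumes "j < 2 ^ m" "q \<le> Q" "Q \<le> m"
  shows "\<Delta> q (j div 2 ^ q) \<le> \<theta> ^ (Q - q) * \<Delta> Q (j div 2 ^ Q)"
  using assms(2,3)
proof (induction Q rule: dec_induct)
  case (step Q)
  have "\<Delta> q (j div 2 ^ q) \<le> \<theta> ^ (Q - q) * \<Delta> Q (j div 2 ^ Q)"
    using step by auto
  also have "\<dots> \<le> \<theta> ^ (Q - q) * (\<theta> * \<Delta> (Suc Q) (j div 2 ^ Q div 2))"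
    using halving[of Q "j div 2 ^ Q"] block_less[OF assms(1), of Q] step theta
    by (intro mult_left_mono) (auto simp: \<Delta>_def)
  also have "\<dots> = \<theta> ^ (Suc Q - q) * \<Delta> (Suc Q) (j div 2 ^ Suc Q)"
    using step by (simp add: Suc_diff_le div_mult2_eq[symmetric] mult.commute)
  finally show ?case .
qed simp

lemma anc_diff:
  assumes "j < 2 ^ m" "q \<le> m"
  shows "0 \<le> s (anc q j) - s j" "s (anc q j) - s j \<le> \<Delta> q (j div 2 ^ q)"
proof -
  show "0 \<le> s (anc q j) - s j"
    using antimono[OF anc_le, of j q] assms by simp
  have "j \<le> Suc (j div 2 ^ q) * 2 ^ q"
    by (metis dividend_less_div_times less_imp_le mult_Suc add.commute pos2 zero_less_power)
  then have "s (Suc (j div 2 ^ q) * 2 ^ q) \<le> s j"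
    using antimono block_end[OF block_less[OF assms]] assms by blast
  then show "s (anc q j) - s j \<le> \<Delta> q (j div 2 ^ q)"
    by (simp add: \<Delta>_def anc_def)
qed

lemma sum_\<Delta>:
  assumes "q \<le> m"
  shows "(\<Sum>p<2 ^ (m - q). \<Delta> q p) = s 0 - s (2 ^ m)"
  using sum_lessThan_telescope'[of "\<lambda>p. s (p * 2 ^ q)" "2 ^ (m - q)"] assms
  by (simp add: \<Delta>_def flip: power_add)

text \<open>The bound is the fixed point of g -> \<theta> g + \<theta>, the recursion that the sums
  obey from Q = 1 on.\<close>

lemma geometric_sum_bound:
  "(\<Sum>q = 1..<Q. \<theta> ^ (Q - q)) \<le> \<theta> / (1 - \<theta>)"
proof (induction Q)
  case (Suc Q)
  have "(\<Sum>q = 1..<Suc Q. \<theta> ^ (Suc Q - q)) \<le> \<theta> * (\<Sum>q = 1..<Q. \<theta> ^ (Q - q)) + \<theta>"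
  proof (cases "Q \<ge> 1")
    case True
    have "(\<Sum>q = 1..<Q. \<theta> ^ (Suc Q - q)) = \<theta> * (\<Sum>q = 1..<Q. \<theta> ^ (Q - q))"
      by (auto simp: sum_distrib_left Suc_diff_le intro!: sum.cong)
    then show ?thesis using True by simp
  qed (use theta in auto)
  also have "\<dots> \<le> \<theta> * (\<theta> / (1 - \<theta>)) + \<theta>"
    using Suc theta by (intro add_right_mono mult_left_mono) auto
  also have "\<dots> = \<theta> / (1 - \<theta>)" using theta by (simp add: field_simps)
  finally show ?case .
qed (use theta in auto)

text \<open>Levels q \<ge> Q contribute the same to all lines of a block of level Q. Each of the Q -
  1 lower levels contributes s_j up to a geometrically decaying error. The choice of Q makes the
  total coefficient of s_j only O(1/m).\<close>

lemma line_in_block: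
  fixes x :: real
  assumes "0 \<le> x" "x \<le> 1" "2 \<le> m"
  defines "Q \<equiv> nat \<lfloor>m * (2 - x) / 2\<rfloor>"
  obtains K where "\<And>j. j < 2 ^ m \<Longrightarrow>
    K (j div 2 ^ Q) \<le> s j * x + icpt j \<and>
    s j * x + icpt j \<le> K (j div 2 ^ Q) + 4 / ((1 - \<theta>) * m) * \<Delta> Q (j div 2 ^ Q)"
proof -
  \<comment> \<open>the coefficient of \<open>s j\<close> left over after cancellation with the levels below \<open>Q\<close>\<close>
  define \<kappa> where "\<kappa> = x - 2 + 2 * (real Q - 1) / m"
  have m0: "real m > 0" using m_pos by simp
  have fl: "0 \<le> m * (2 - x) / 2" using assms by simp
  \<comment> \<open>Q \<ge> 1 is what allows the sum over levels 1..m to be cut at Q.\<close>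
  have "1 \<le> m * (2 - x) / 2"
    using mult_mono[of 2 "real m" 1 "2 - x"] assms by simp
  then have Q1: "1 \<le> Q" unfolding Q_def by linarith
  have rQ: "real Q \<le> m * (2 - x) / 2" "m * (2 - x) / 2 < real Q + 1"
    unfolding Q_def using fl by linarith+
  have "m * (2 - x) / 2 \<le> m" using assms m0 by (simp add: field_simps)
  then have Qm: "Q \<le> m" using rQ by linarith
  \<comment> \<open>The floor gives 2 - x - 2/m < 2Q/m \<le> 2 - x.\<close>
  have \<kappa>: "- (4 / m) \<le> \<kappa>" "\<kappa> \<le> 0"
    using rQ m0 by (auto simp: \<kappa>_def field_simps)
  \<comment> \<open>For P = \<open>j div 2 ^ Q\<close> the summand is \<open>s (anc q j)\<close>;
    the leftover multiple of s_j is evaluated at the left end of the block instead.\<close>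
  define K where "K P = 2 / m * (\<Sum>q = Q..m. s (P div 2 ^ (q - Q) * 2 ^ q)) + \<kappa> * s (P * 2 ^ Q)" for P
  have "K (j div 2 ^ Q) \<le> s j * x + icpt j \<and>
    s j * x + icpt j \<le> K (j div 2 ^ Q) + 4 / ((1 - \<theta>) * m) * \<Delta> Q (j div 2 ^ Q)" if j: "j < 2 ^ m" for j
  proof -
    let ?D = "\<Delta> Q (j div 2 ^ Q)" and ?E = "\<Sum>q = 1..<Q. s (anc q j) - s j"
    have D0: "0 \<le> ?D" using \<Delta>_nonneg block_less j Qm by blast
    have "j div 2 ^ Q div 2 ^ (q - Q) = j div 2 ^ q" if "Q \<le> q" for q
      using that by (simp add: div_mult2_eq[symmetric] flip: power_add)
    then have K: "K (j div 2 ^ Q) = 2 / m * (\<Sum>q = Q..m. s (anc q j)) + \<kappa> * s (anc Q j)"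
      by (simp add: K_def anc_def)
    have "(\<Sum>q = 1..m. s (anc q j) - s j) = ?E + (\<Sum>q = Q..m. s (anc q j) - s j)"
      using sum.atLeastLessThan_concat[of 1 Q "Suc m" "\<lambda>q. s (anc q j) - s j"] Q1 Qm
      by (simp add: atLeastLessThanSuc_atLeastAtMost)
    also have "(\<Sum>q = Q..m. s (anc q j) - s j) = (\<Sum>q = Q..m. s (anc q j)) - (m + 1 - real Q) * s j"
      using Qm by (simp add: sum_subtractf of_nat_diff)
    finally have "s j * x + icpt j =
        s j * x + 2 / m * (?E + (\<Sum>q = Q..m. s (anc q j)) - (m + 1 - real Q) * s j)"
      by (simp add: icpt_def)
    also have "\<dots> = K (j div 2 ^ Q) + 2 / m * ?E - \<kappa> * (s (anc Q j) - s j)"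
      using m0 by (simp add: K \<kappa>_def field_simps)
    finally have eq: "s j * x + icpt j = K (j div 2 ^ Q) + 2 / m * ?E + (- \<kappa>) * (s (anc Q j) - s j)" by simp
    have E0: "0 \<le> ?E" using anc_diff(1)[OF j] Qm by (intro sum_nonneg) auto
    have "?E \<le> (\<Sum>q = 1..<Q. \<theta> ^ (Q - q) * ?D)"
      using anc_diff(2)[OF j] \<Delta>_decay[OF j _ Qm] Qm
      by (intro sum_mono) (smt (verit) atLeastLessThan_iff le_trans less_imp_le)
    also have "\<dots> \<le> \<theta> / (1 - \<theta>) * ?D"
      unfolding sum_distrib_right[symmetric] by (intro mult_right_mono geometric_sum_bound D0)
    finally have E: "2 / m * ?E \<le> 2 / m * (\<theta> / (1 - \<theta>) * ?D)"
      using m0 by (intro mult_left_mono) auto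
    have A: "0 \<le> s (anc Q j) - s j" "s (anc Q j) - s j \<le> ?D"
      using anc_diff[OF j Qm] by auto
    have F: "(- \<kappa>) * (s (anc Q j) - s j) \<le> 4 / m * ?D"
      using A \<kappa> m0 by (intro mult_mono) auto
    \<comment> \<open>The lower levels cost 2 \<theta> / (1 - \<theta>) and the leftover coefficient
      costs 4, in units of 1/m times the slope drop.\<close>
    have "2 / m * (\<theta> / (1 - \<theta>) * ?D) + 4 / m * ?D = (4 - 2 * \<theta>) / ((1 - \<theta>) * m) * ?D"
      using m0 theta by (simp add: field_simps)
    also have "\<dots> \<le> 4 / ((1 - \<theta>) * m) * ?D"
      using m0 theta D0 by (intro mult_right_mono divide_right_mono) auto
    finally have G: "2 / m * (\<theta> / (1 - \<theta>) * ?D) + 4 / m * ?D \<le> 4 / ((1 - \<theta>) * m) * ?D" .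
    have "0 \<le> 2 / m * ?E" "0 \<le> (- \<kappa>) * (s (anc Q j) - s j)"
      using E0 A \<kappa> m0 by (auto intro!: mult_nonneg_nonneg mult_nonpos_nonneg simp del: mult_minus_left)
    then show ?thesis using eq E F G by linarith
  qed
  then show thesis using that by blast
qed

text \<open>For x \<ge> 3 the coefficient x - 2 is at least 1, so (x - 2) s_j alone produces the
  gap; the sums of ancestor slopes are nonincreasing in j and can only widen it.\<close>

lemma lines_apart:
  assumes "i < j" "j < 2 ^ m" "3 \<le> x"
  shows "s j * x + icpt j \<le> s i * x + icpt i - (s i - s (Suc i))"
proof -
  have m0: "real m > 0" using m_pos by simp
  have ic: "s k * x + icpt k = (x - 2) * s k + 2 / m * (\<Sum>q = 1..m. s (anc q k))" for k
    using m0 by (simp add: icpt_def sum_subtractf field_simps)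
  have "2 / m * (\<Sum>q = 1..m. s (anc q j)) \<le> 2 / m * (\<Sum>q = 1..m. s (anc q i))"
    using m0 assms anc_mono[of i j] le_trans[OF anc_le[of _ j], of "2 ^ m"]
    by (intro mult_left_mono sum_mono antimono) auto
  moreover have "(x - 2) * s j \<le> (x - 2) * s (Suc i)"
    using assms by (intro mult_left_mono antimono) auto
  moreover have "1 * (s i - s (Suc i)) \<le> (x - 2) * (s i - s (Suc i))"
    using assms antimono[of i "Suc i"] by (intro mult_right_mono) auto
  ultimately show ?thesis unfolding ic by (simp add: algebra_simps)
qed

definition near_tubes :: "real \<Rightarrow> (real^2) set" where
  "near_tubes M = (\<Union>j<2 ^ m. strip (s j) {0..1} {icpt j - M * (s j - s (Suc j))..icpt j})"

text \<open>Open intervals keep tubes disjoint even when their upper lines are exactly one width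
  apart.\<close>

definition far_tubes :: "(real^2) set" where
  "far_tubes = (\<Union>j<2 ^ m. strip (s j) {3..4} {icpt j - (s j - s (Suc j))<..<icpt j})"

lemma near_tubes_borel: "near_tubes M \<in> sets borel"
  unfolding near_tubes_def by (intro sets.finite_UN strip_borel) auto

text \<open>Over each x, one interval per block of level Q covers the section. The first term of the
  factor accounts for the thickness of a tube, the second for the spread of the lines in a block;
  the slope drops of all blocks add up to \<open>s 0 - s (2 ^ m)\<close>.\<close>

lemma emeasure_near_tubes_le:
  assumes M: "0 \<le> M" and m2: "2 \<le> m"
  shows "emeasure lebesgue (near_tubes M) \<le>
    ennreal ((M * \<theta> ^ (m div 2) + 4 / ((1 - \<theta>) * m)) * (s 0 - s (2 ^ m)))"
    (is "_ \<le> ennreal (?e * ?S)")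
proof -
  have S0: "0 \<le> ?S" using antimono by simp
  have "emeasure lborel {y. vector [x, y] \<in> near_tubes M} \<le> ennreal (?e * ?S) * indicator {0..1} x" for x
  proof (cases "x \<in> {0..1}")
    case True
    define Q where "Q = nat \<lfloor>m * (2 - x) / 2\<rfloor>"
    \<comment> \<open>x \<le> 1 forces Q \<ge> \<open>m div 2\<close>, which makes the final bound
      uniform in x.\<close>
    have "real m / 2 \<le> m * (2 - x) / 2" "m * (2 - x) / 2 \<le> m"
      using True mult_right_mono[of x 1 "real m"] by (auto simp: field_simps)
    then have Qm: "Q \<le> m" "m div 2 \<le> Q"
      unfolding Q_def by linarith+
    from True m2 obtain K where K: "\<And>j. j < 2 ^ m \<Longrightarrow>
        K (j div 2 ^ Q) \<le> s j * x + icpt j \<and>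
        s j * x + icpt j \<le> K (j div 2 ^ Q) + 4 / ((1 - \<theta>) * m) * \<Delta> Q (j div 2 ^ Q)"
      using line_in_block[of x] unfolding Q_def by auto
    define I where "I P = {K P - M * \<theta> ^ Q * \<Delta> Q P..K P + 4 / ((1 - \<theta>) * m) * \<Delta> Q P}" for P
    let ?c = "M * \<theta> ^ Q + 4 / ((1 - \<theta>) * m)"
    have c0: "0 \<le> ?c" using M theta by simp
    have "{y. vector [x, y] \<in> near_tubes M} \<subseteq> (\<Union>P<2 ^ (m - Q). I P)"
    proof
      fix y assume "y \<in> {y. vector [x, y] \<in> near_tubes M}"
      then obtain j where j: "j < 2 ^ m"
        and y: "s j * x + icpt j - M * (s j - s (Suc j)) \<le> y" "y \<le> s j * x + icpt j"
        by (auto simp: near_tubes_def strip_def)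
      \<comment> \<open>The level 0 block of j is a single index, so decay from level 0 bounds the
        tube width.\<close>
      have "s j - s (Suc j) \<le> \<theta> ^ Q * \<Delta> Q (j div 2 ^ Q)"
        using \<Delta>_decay[OF j, of 0 Q] Qm by (simp add: \<Delta>_def)
      then have "M * (s j - s (Suc j)) \<le> M * \<theta> ^ Q * \<Delta> Q (j div 2 ^ Q)"
        using M by (simp add: mult.assoc mult_left_mono)
      then have "y \<in> I (j div 2 ^ Q)" using y K[OF j] by (auto simp: I_def)
      then show "y \<in> (\<Union>P<2 ^ (m - Q). I P)" using block_less[OF j Qm(1)] by blast
    qed
    then have "emeasure lborel {y. vector [x, y] \<in> near_tubes M} \<le> emeasure lborel (\<Union>P<2 ^ (m - Q). I P)"
      by (rule emeasure_mono) (auto simp: I_def)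
    also have "\<dots> \<le> (\<Sum>P<2 ^ (m - Q). emeasure lborel (I P))"
      by (intro emeasure_subadditive_finite) (auto simp: I_def)
    also have "\<dots> = (\<Sum>P<2 ^ (m - Q). ennreal (?c * \<Delta> Q P))"
    proof (intro sum.cong refl)
      fix P :: nat assume "P \<in> {..<2 ^ (m - Q)}"
      then have "0 \<le> \<Delta> Q P" using \<Delta>_nonneg Qm by auto
      then have "0 \<le> ?c * \<Delta> Q P" using c0 by (rule mult_nonneg_nonneg[rotated])
      then show "emeasure lborel (I P) = ennreal (?c * \<Delta> Q P)"
        by (simp add: I_def algebra_simps)
    qed
    also have "\<dots> = ennreal (\<Sum>P<2 ^ (m - Q). ?c * \<Delta> Q P)"
      using \<Delta>_nonneg Qm c0 by (intro sum_ennreal mult_nonneg_nonneg) auto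
    also have "(\<Sum>P<2 ^ (m - Q). ?c * \<Delta> Q P) = ?c * ?S"
      using sum_\<Delta>[OF Qm(1)] by (simp flip: sum_distrib_left)
    also have "ennreal (?c * ?S) \<le> ennreal (?e * ?S)"
      using M theta S0 Qm
      by (intro ennreal_leI mult_right_mono add_right_mono mult_left_mono power_decreasing) auto
    finally show ?thesis using True by simp
  qed (auto simp: near_tubes_def strip_def)
  then have "emeasure lebesgue (near_tubes M) \<le> (\<integral>\<^sup>+ x. ennreal (?e * ?S) * indicator {0..1::real} x \<partial>lborel)"
    unfolding emeasure_vec2[OF near_tubes_borel] by (intro nn_integral_mono) auto
  then show ?thesis by (simp add: nn_integral_cmult_indicator)
qed

text \<open>Positive measure is needed to normalise the indicator; the tube of index 0 supplies
  it.\<close>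

lemma emeasure_near_tubes_pos:
  assumes "0 < M" "s (Suc 0) < s 0"
  shows "0 < emeasure lebesgue (near_tubes M)"
proof -
  have "0 < emeasure lebesgue (strip (s 0) {0..1} {icpt 0 - M * (s 0 - s (Suc 0))..icpt 0})"
    using assms by (simp add: emeasure_strip)
  also have "\<dots> \<le> emeasure lebesgue (near_tubes M)"
  proof (rule emeasure_mono)
    show "strip (s 0) {0..1} {icpt 0 - M * (s 0 - s (Suc 0))..icpt 0} \<subseteq> near_tubes M"
      unfolding near_tubes_def by (rule UN_upper) simp
  qed (use near_tubes_borel in simp)
  finally show ?thesis .
qed

lemma far_tubes_borel: "far_tubes \<in> sets borel"
  unfolding far_tubes_def by (intro sets.finite_UN strip_borel) auto

text \<open>The tubes are disjoint, have base length 1, and their widths telescope.\<close>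

lemma emeasure_far_tubes: "emeasure lebesgue far_tubes = ennreal (s 0 - s (2 ^ m))"
proof -
  let ?Y = "\<lambda>j. strip (s j) {3..4} {icpt j - (s j - s (Suc j))<..<icpt j}"
  have "?Y i \<inter> ?Y j = {}" if "i < j" "j < 2 ^ m" for i j
    using lines_apart[OF that] by (force simp: strip_def mult.commute)
  then have disj: "disjoint_family_on ?Y {..<2 ^ m}"
    unfolding disjoint_family_on_def by (metis Int_commute lessThan_iff linorder_neqE_nat)
  have "emeasure lebesgue far_tubes = (\<Sum>j<2 ^ m. emeasure lebesgue (?Y j))"
    unfolding far_tubes_def using disj strip_borel
    by (intro sum_emeasure[symmetric]) auto
  also have "\<dots> = (\<Sum>j<2 ^ m. ennreal (s j - s (Suc j)))"
    using antimono by (intro sum.cong) (auto simp: emeasure_strip)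
  also have "\<dots> = ennreal (\<Sum>j<2 ^ m. s j - s (Suc j))"
    using antimono by (intro sum_ennreal) auto
  finally show ?thesis by (simp add: sum_lessThan_telescope')
qed

end

subsection \<open>Lower bounds for the maximal operator\<close>

lemma rectangle_in_dilates:
  assumes "rectangle_with_ecc_orient R e \<omega>" "R \<in> \<B>" "0 < L"
  shows "rectangle c \<omega> L (L * e) \<in> dilates \<B>"
proof -
  obtain c0 a b where ab: "0 < b" "b \<le> a" and R: "R = rectangle c0 \<omega> a b" and e: "e = b / a"
    using assms(1) unfolding rectangle_with_ecc_orient_def by blast
  define h where "h = L / a"
  have h: "0 < h" "h * a = L" "h * b = L * e"
    using ab assms(3) by (auto simp: h_def e)
  let ?T = "\<lambda>y. (c - h *\<^sub>R c0) + h *\<^sub>R y"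
  have "?T ` R = rectangle c \<omega> L (L * e)"
  proof
    show "?T ` R \<subseteq> rectangle c \<omega> L (L * e)"
    proof
      fix z assume "z \<in> ?T ` R"
      then obtain u v where uv: "0 \<le> u" "u \<le> a" "0 \<le> v" "v \<le> b" and
        z: "z = ?T (c0 + u *\<^sub>R vector [cos \<omega>, sin \<omega>] + v *\<^sub>R vector [- sin \<omega>, cos \<omega>])"
        unfolding R rectangle_def by blast
      have "z = c + (h * u) *\<^sub>R vector [cos \<omega>, sin \<omega>] + (h * v) *\<^sub>R vector [- sin \<omega>, cos \<omega>]"
        by (simp add: z scaleR_add_right)
      moreover have "0 \<le> h * u" "h * u \<le> L" "0 \<le> h * v" "h * v \<le> L * e"
        using uv h by (auto simp flip: h(2,3))
      ultimately show "z \<in> rectangle c \<omega> L (L * e)"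
        unfolding rectangle_def by blast
    qed
    show "rectangle c \<omega> L (L * e) \<subseteq> ?T ` R"
    proof
      fix z assume "z \<in> rectangle c \<omega> L (L * e)"
      then obtain u v where uv: "0 \<le> u" "u \<le> L" "0 \<le> v" "v \<le> L * e" and
        z: "z = c + u *\<^sub>R vector [cos \<omega>, sin \<omega>] + v *\<^sub>R vector [- sin \<omega>, cos \<omega>]"
        unfolding rectangle_def by blast
      have "z = ?T (c0 + (u / h) *\<^sub>R vector [cos \<omega>, sin \<omega>] + (v / h) *\<^sub>R vector [- sin \<omega>, cos \<omega>])"
        using h by (simp add: z scaleR_add_right)
      moreover have "0 \<le> u / h" "u / h \<le> a" "0 \<le> v / h" "v / h \<le> b"
        using uv h by (auto simp: pos_divide_le_eq mult.commute)
      ultimately show "z \<in> ?T ` R"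
        unfolding R rectangle_def by blast
    qed
  qed
  then show ?thesis
    using assms(2) h(1) unfolding dilates_def by blast
qed

text \<open>Length 8 suffices to reach back from abscissa 3..4 across all of 0..1. The rectangle
  stays within a strip of the same vertical thickness over -5..5, so the part over 0..1 has density
  at least 1/10.\<close>

lemma rectangle_average:
  fixes z :: "real^2" and \<theta> b :: real
  assumes \<theta>: "0 \<le> \<theta>" "\<theta> \<le> pi / 4" and b: "0 < b" "b \<le> 1" and z: "3 \<le> z$1" "z$1 \<le> 4"
  defines "\<eta> \<equiv> z$2 - tan \<theta> * z$1"
  obtains c \<beta> where "0 < \<beta>" "\<beta> \<le> 2 * b" "z \<in> rectangle c \<theta> 8 b"
    "strip (tan \<theta>) {0..1} {\<eta> - \<beta>..\<eta>} \<subseteq> rectangle c \<theta> 8 b"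
    "ennreal (1 / 10) \<le> emeasure lebesgue (strip (tan \<theta>) {0..1} {\<eta> - \<beta>..\<eta>}) / emeasure lebesgue (rectangle c \<theta> 8 b)"
proof -
  \<comment> \<open>\<open>z\<close> is the top right corner, so the rectangle lies below the line of slope \<open>tan \<theta>\<close> through \<open>z\<close>\<close>
  define c where "c = z - 8 *\<^sub>R vector [cos \<theta>, sin \<theta>] - b *\<^sub>R vector [- sin \<theta>, cos \<theta>]"
  \<comment> \<open>The vertical thickness of a rectangle of width b and slope
    \<open>tan \<theta>\<close>.\<close>
  define \<beta> where "\<beta> = b / cos \<theta>"
  \<comment> \<open>The bound 7/10 gives 8 cos \<theta> \<ge> 5, enough for a horizontal reach of 4
    + 1, and also \<beta> \<le> 2b.\<close>
  have "cos (pi / 4) \<le> cos \<theta>"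
    using \<theta> by (intro cos_monotone_0_pi_le) auto
  moreover have "7 / 5 \<le> sqrt 2" by (intro real_le_rsqrt) (simp add: power2_eq_square)
  ultimately have cos: "7 / 10 \<le> cos \<theta>" by (simp add: cos_45)
  then have cos0: "0 < cos \<theta>" by simp
  have sin0: "0 \<le> sin \<theta>" using \<theta> by (intro sin_ge_zero) auto
  have tc: "tan \<theta> * cos \<theta> = sin \<theta>" using cos0 by (simp add: tan_def)
  have pyth: "sin \<theta> * sin \<theta> + cos \<theta> * cos \<theta> = 1"
    using sin_cos_squared_add[of \<theta>] by (simp add: power2_eq_square)
  have sec: "tan \<theta> * sin \<theta> + cos \<theta> = 1 / cos \<theta>"
    using cos0 pyth by (simp add: tan_def field_simps)
  have \<beta>0: "0 < \<beta>" using b cos0 by (simp add: \<beta>_def)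
  have "b \<le> 2 * b * cos \<theta>" using b cos mult_left_mono[of "1/2" "cos \<theta>" "2 * b"] by simp
  then have \<beta>2: "\<beta> \<le> 2 * b" using cos0 by (simp add: \<beta>_def pos_divide_le_eq)
  have zR: "z \<in> rectangle c \<theta> 8 b"
    unfolding rectangle_def c_def using b
    by (intro CollectI exI[of _ 8] exI[of _ b]) simp
  have sub: "strip (tan \<theta>) {0..1} {\<eta> - \<beta>..\<eta>} \<subseteq> rectangle c \<theta> 8 b"
  proof
    fix y assume "y \<in> strip (tan \<theta>) {0..1} {\<eta> - \<beta>..\<eta>}"
    then have y: "0 \<le> y$1" "y$1 \<le> 1" "\<eta> - \<beta> \<le> y$2 - tan \<theta> * y$1" "y$2 - tan \<theta> * y$1 \<le> \<eta>"
      by (auto simp: strip_def)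
    \<comment> \<open>u and v are the coordinates of y measured back from the corner z along the two
      sides.\<close>
    define v where "v = (\<eta> - (y$2 - tan \<theta> * y$1)) * cos \<theta>"
    define u where "u = (z$1 - y$1 + v * sin \<theta>) / cos \<theta>"
    have "(\<eta> - (y$2 - tan \<theta> * y$1)) * cos \<theta> \<le> \<beta> * cos \<theta>"
      using y cos0 by (intro mult_right_mono) auto
    then have v: "0 \<le> v" "v \<le> b" using y cos0 by (auto simp: v_def \<beta>_def)
    have "v * sin \<theta> \<le> 1 * 1" using v b sin0 by (intro mult_mono) auto
    then have "z$1 - y$1 + v * sin \<theta> \<le> 8 * cos \<theta>" using z y cos by simp
    then have u: "0 \<le> u" "u \<le> 8"
      using cos0 z y v sin0 by (auto simp: u_def pos_divide_le_eq)
    have uc: "u * cos \<theta> = z$1 - y$1 + v * sin \<theta>" using cos0 by (simp add: u_def)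
    have "v * (tan \<theta> * sin \<theta> + cos \<theta>) = \<eta> - (y$2 - tan \<theta> * y$1)"
      unfolding sec using cos0 by (simp add: v_def)
    moreover have "u * sin \<theta> = tan \<theta> * (z$1 - y$1 + v * sin \<theta>)"
      unfolding uc[symmetric] by (simp flip: tc)
    ultimately have us: "u * sin \<theta> + v * cos \<theta> = z$2 - y$2"
      by (simp add: \<eta>_def algebra_simps)
    have "y = c + (8 - u) *\<^sub>R vector [cos \<theta>, sin \<theta>] + (b - v) *\<^sub>R vector [- sin \<theta>, cos \<theta>]"
      using uc us by (simp add: vec_eq_iff forall_2 c_def algebra_simps)
    then show "y \<in> rectangle c \<theta> 8 b"
      unfolding rectangle_def using u v by (intro CollectI exI[of _ "8 - u"] exI[of _ "b - v"]) simp
  qed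
  have sup: "rectangle c \<theta> 8 b \<subseteq> strip (tan \<theta>) {- 5..5} {\<eta> - \<beta>..\<eta>}"
  proof
    fix y assume "y \<in> rectangle c \<theta> 8 b"
    then obtain u v where uv: "0 \<le> u" "u \<le> 8" "0 \<le> v" "v \<le> b" and
      y: "y = c + u *\<^sub>R vector [cos \<theta>, sin \<theta>] + v *\<^sub>R vector [- sin \<theta>, cos \<theta>]"
      unfolding rectangle_def by blast
    have y1: "y$1 = z$1 - (8 - u) * cos \<theta> + (b - v) * sin \<theta>"
      and y2: "y$2 = z$2 - (8 - u) * sin \<theta> - (b - v) * cos \<theta>"
      by (simp_all add: y c_def algebra_simps)
    have "(8 - u) * cos \<theta> \<le> 8 * 1" "(b - v) * sin \<theta> \<le> 1 * 1"
      using uv b cos0 sin0 by (intro mult_mono; simp)+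
    moreover have "0 \<le> (8 - u) * cos \<theta>" "0 \<le> (b - v) * sin \<theta>"
      using uv cos0 sin0 by simp_all
    ultimately have r1: "y$1 \<in> {- 5..5}" using z unfolding y1 by simp
    have "y$2 - tan \<theta> * y$1 = \<eta> + (8 - u) * (tan \<theta> * cos \<theta> - sin \<theta>) - (b - v) * (tan \<theta> * sin \<theta> + cos \<theta>)"
      by (simp add: y1 y2 \<eta>_def algebra_simps)
    also have "\<dots> = \<eta> - (b - v) / cos \<theta>" by (simp add: tc sec)
    finally have "y$2 - tan \<theta> * y$1 = \<eta> - (b - v) / cos \<theta>" .
    moreover have "0 \<le> (b - v) / cos \<theta>" "(b - v) / cos \<theta> \<le> \<beta>"
      using uv cos0 by (auto simp: \<beta>_def intro!: divide_right_mono)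
    ultimately show "y \<in> strip (tan \<theta>) {- 5..5} {\<eta> - \<beta>..\<eta>}"
      using r1 by (simp add: strip_def)
  qed
  have "emeasure lebesgue (rectangle c \<theta> 8 b) \<le> emeasure lebesgue (strip (tan \<theta>) {- 5..5} {\<eta> - \<beta>..\<eta>})"
    using strip_borel by (intro emeasure_mono sup) auto
  also have "\<dots> = ennreal (10 * \<beta>)" using \<beta>0 by (simp add: emeasure_strip ennreal_mult)
  finally obtain r where r: "emeasure lebesgue (rectangle c \<theta> 8 b) = ennreal r" "0 \<le> r" "r \<le> 10 * \<beta>"
    using \<beta>0 by (cases "emeasure lebesgue (rectangle c \<theta> 8 b)") (auto simp: top_unique)
  \<comment> \<open>If r = 0 the quotient is infinite, since \<beta> > 0.\<close>
  have "ennreal (1 / 10) \<le> ennreal \<beta> / ennreal r"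
    using r(2,3) \<beta>0 by (cases "r = 0") (auto simp: divide_ennreal field_simps ennreal_divide_zero)
  moreover have "emeasure lebesgue (strip (tan \<theta>) {0..1} {\<eta> - \<beta>..\<eta>}) = ennreal \<beta>"
    using \<beta>0 by (simp add: emeasure_strip)
  ultimately show thesis using that[OF \<beta>0 \<beta>2 zR sub] r(1) by simp
qed

section \<open>From densities to lower bounds for the operator norm\<close>

lemma ennreal_powr_mono:
  assumes "x \<le> y" "0 \<le> p"
  shows "ennreal_powr x p \<le> ennreal_powr y p"
  using assms
  by (auto simp: ennreal_powr_def top_unique less_top intro!: ennreal_leI powr_mono2 enn2real_mono)

lemma ennreal_powr_ennreal:
  "0 \<le> x \<Longrightarrow> ennreal_powr (ennreal x) p = ennreal (x powr p)"
  by (simp add: ennreal_powr_def)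

text \<open>Tests the operator on a^(-1/p) times the indicator of X, which has norm 1; on Y its
  maximal function is at least \<gamma> a^(-1/p).\<close>

lemma maximal_norm_ge:
  fixes X Y :: "(real^2) set" and a b \<gamma> p :: real
  assumes X: "X \<in> sets lebesgue" "emeasure lebesgue X = ennreal a" "0 < a"
    and Y: "Y \<in> sets lebesgue" "emeasure lebesgue Y = ennreal b" "0 < b"
    and "0 < \<gamma>" "0 < p"
    and dens: "\<And>z. z \<in> Y \<Longrightarrow> \<exists>R\<in>dilates \<B>. \<exists>P\<in>sets lebesgue. z \<in> R \<and> P \<subseteq> R \<inter> X \<and>
      ennreal \<gamma> \<le> emeasure lebesgue P / emeasure lebesgue R"
  shows "ennreal (\<gamma> * (b / a) powr (1 / p)) \<le> maximal_norm \<B> p"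
proof -
  define l where "l = a powr (- 1 / p)"
  define f where "f z = l * indicator X z" for z :: "real^2"
  have l0: "0 < l" using X by (simp add: l_def)
  have "l powr p = a powr - 1" using \<open>0 < p\<close> by (simp add: l_def powr_powr)
  then have lp: "l powr p = 1 / a" using X by (simp add: powr_minus_divide)
  have f_meas: "f \<in> borel_measurable lebesgue"
    unfolding f_def using X by simp
  have "ennreal_powr (ennreal \<bar>f z\<bar>) p = ennreal (1 / a) * indicator X z" for z
    using l0 \<open>0 < p\<close> by (auto simp: f_def ennreal_powr_ennreal lp indicator_def)
  then have "(\<integral>\<^sup>+ z. ennreal_powr (ennreal \<bar>f z\<bar>) p \<partial>lebesgue) = ennreal (1 / a) * ennreal a"
    using X by (simp add: nn_integral_cmult_indicator)
  also have "\<dots> = ennreal 1" using X by (simp flip: ennreal_mult)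
  finally have norm1: "Lp_norm p (\<lambda>z. ennreal \<bar>f z\<bar>) = 1"
    unfolding Lp_norm_def using ennreal_powr_ennreal[of 1] by simp
  have low: "ennreal (\<gamma> * l) \<le> geometric_maximal \<B> f z" if z: "z \<in> Y" for z
  proof -
    from dens[OF z] obtain R P where R: "R \<in> dilates \<B>" "z \<in> R" and P: "P \<in> sets lebesgue" "P \<subseteq> R \<inter> X"
      and dP: "ennreal \<gamma> \<le> emeasure lebesgue P / emeasure lebesgue R" by blast
    have "ennreal (\<gamma> * l) = ennreal l * ennreal \<gamma>" using l0 \<open>0 < \<gamma>\<close> by (simp add: ennreal_mult mult.commute)
    also have "\<dots> \<le> ennreal l * (emeasure lebesgue P / emeasure lebesgue R)"
      by (intro mult_left_mono dP) simp
    also have "\<dots> = (\<integral>\<^sup>+ y. ennreal l * indicator P y \<partial>lebesgue) / emeasure lebesgue R"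
      using P by (simp add: nn_integral_cmult_indicator ennreal_times_divide)
    also have "\<dots> \<le> (\<integral>\<^sup>+ y \<in> R. ennreal \<bar>f y\<bar> \<partial>lebesgue) / emeasure lebesgue R"
      using P l0 by (intro divide_right_mono_ennreal nn_integral_mono) (auto simp: f_def indicator_def)
    also have "\<dots> \<le> geometric_maximal \<B> f z"
      unfolding geometric_maximal_def using R by (intro SUP_upper) auto
    finally show ?thesis .
  qed
  have "ennreal ((\<gamma> * l) powr p) * indicator Y z \<le> ennreal_powr (geometric_maximal \<B> f z) p" for z
    using ennreal_powr_mono[OF low, of z p] l0 \<open>0 < \<gamma>\<close> \<open>0 < p\<close>
    by (auto simp: ennreal_powr_ennreal indicator_def)
  then have "(\<integral>\<^sup>+ z. ennreal ((\<gamma> * l) powr p) * indicator Y z \<partial>lebesgue)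
      \<le> (\<integral>\<^sup>+ z. ennreal_powr (geometric_maximal \<B> f z) p \<partial>lebesgue)"
    by (intro nn_integral_mono) auto
  then have "ennreal ((\<gamma> * l) powr p * b) \<le> (\<integral>\<^sup>+ z. ennreal_powr (geometric_maximal \<B> f z) p \<partial>lebesgue)"
    using Y by (simp add: nn_integral_cmult_indicator ennreal_mult)
  then have "ennreal_powr (ennreal ((\<gamma> * l) powr p * b)) (1 / p) \<le> Lp_norm p (geometric_maximal \<B> f)"
    unfolding Lp_norm_def using \<open>0 < p\<close> by (intro ennreal_powr_mono) auto
  also have "(\<gamma> * l) powr p * b = \<gamma> powr p * (b / a)"
    using l0 \<open>0 < \<gamma>\<close> by (simp add: powr_mult lp)
  also have "ennreal_powr (ennreal (\<gamma> powr p * (b / a))) (1 / p) = ennreal (\<gamma> * (b / a) powr (1 / p))"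
    using X Y \<open>0 < \<gamma>\<close> \<open>0 < p\<close> by (simp add: ennreal_powr_ennreal powr_mult powr_powr powr_divide)
  finally have "ennreal (\<gamma> * (b / a) powr (1 / p)) \<le> Lp_norm p (geometric_maximal \<B> f)" .
  also have "\<dots> \<le> maximal_norm \<B> p"
    unfolding maximal_norm_def using f_meas norm1 by (intro SUP_upper) auto
  finally show ?thesis .
qed

subsection \<open>Slopes with finite \<open>\<tau>\<close>\<close>

text \<open>Mean value theorem: the derivative 1/cos^2 lies between 1 and 2 on [0, pi/4].\<close>

lemma tan_diff_bounds:
  fixes x y :: real
  assumes "0 \<le> y" "y \<le> x" "x \<le> pi / 4"
  shows "x - y \<le> tan x - tan y" "tan x - tan y \<le> 2 * (x - y)"
proof -
  have cs: "1/2 \<le> (cos z)\<^sup>2 \<and> (cos z)\<^sup>2 \<le> 1 \<and> cos z > 0" if "y \<le> z" "z \<le> x" for z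
  proof -
    have "cos (pi/4) \<le> cos z"
      using that assms by (intro cos_monotone_0_pi_le) (auto)
    then have *: "sqrt 2 / 2 \<le> cos z" by (simp add: cos_45)
    then have "(sqrt 2 / 2)\<^sup>2 \<le> (cos z)\<^sup>2" by (intro power_mono) auto
    moreover have "0 < cos z" using * by (smt (verit) divide_pos_pos real_sqrt_gt_0_iff)
    ultimately show ?thesis by (auto simp: power_divide abs_square_le_1)
  qed
  have d: "DERIV tan z :> inverse ((cos z)\<^sup>2)" if "y \<le> z" "z \<le> x" for z
    using cs[OF that] by (intro DERIV_tan) auto
  show "x - y \<le> tan x - tan y"
  proof (cases "y < x")
    case True
    obtain z where z: "z > y" "z < x" "tan x - tan y = (x - y) * inverse ((cos z)\<^sup>2)"
      using MVT2[OF True, of tan "\<lambda>z. inverse ((cos z)\<^sup>2)"] d by blast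
    have "1 \<le> inverse ((cos z)\<^sup>2)" using cs[of z] z by (auto intro!: one_le_inverse)
    then show ?thesis unfolding z(3) using True by simp
  qed (use assms in auto)
  show "tan x - tan y \<le> 2 * (x - y)"
  proof (cases "y < x")
    case True
    obtain z where z: "z > y" "z < x" "tan x - tan y = (x - y) * inverse ((cos z)\<^sup>2)"
      using MVT2[OF True, of tan "\<lambda>z. inverse ((cos z)\<^sup>2)"] d by blast
    have "inverse ((cos z)\<^sup>2) \<le> inverse (1/2)" using cs[of z] z by (intro le_imp_inverse_le) auto
    then have "(x - y) * inverse ((cos z)\<^sup>2) \<le> (x - y) * 2"
      using True by (intro mult_left_mono) auto
    then show ?thesis unfolding z(3) by simp
  qed (use assms in auto)
qed

text \<open>A bound on the sum of a positive ratio and its reciprocal bounds both.\<close>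

lemma tau_bounded:
  assumes "tau t < \<infinity>" and dec: "\<And>i j. 1 \<le> i \<Longrightarrow> i < j \<Longrightarrow> t j < t i"
  obtains T where "0 \<le> T"
    "\<And>k l. 1 \<le> l \<Longrightarrow> l \<le> k \<Longrightarrow> t k - t (k + l) \<le> T * (t (k + l) - t (k + 2 * l))"
    "\<And>k l. 1 \<le> l \<Longrightarrow> l \<le> k \<Longrightarrow> t (k + l) - t (k + 2 * l) \<le> T * (t k - t (k + l))"
proof -
  obtain n :: nat where n: "tau t < ereal n"
    using assms(1) less_PInf_Ex_of_nat by auto
  have *: "t k - t (k + l) \<le> n * (t (k + l) - t (k + 2 * l)) \<and> t (k + l) - t (k + 2 * l) \<le> n * (t k - t (k + l))"
    if kl: "1 \<le> l" "l \<le> k" for k l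
  proof -
    define A B where "A = t k - t (k + l)" and "B = t (k + l) - t (k + 2 * l)"
    have AB: "0 < A" "0 < B" using kl dec by (auto simp: A_def B_def)
    have "ereal ((t (k + 2 * l) - t (k + l)) / (t (k + l) - t k) + (t (k + l) - t k) / (t (k + 2 * l) - t (k + l))) \<le> tau t"
      unfolding tau_def using kl by (intro SUP_upper2[of k] SUP_upper2[of l]) auto
    \<comment> \<open>As t decreases, numerator and denominator are both negative and may change
      sign together.\<close>
    also have "(t (k + 2 * l) - t (k + l)) / (t (k + l) - t k) = B / A"
      unfolding A_def B_def by (metis minus_diff_eq minus_divide_divide)
    also have "(t (k + l) - t k) / (t (k + 2 * l) - t (k + l)) = A / B"
      unfolding A_def B_def by (metis minus_diff_eq minus_divide_divide)
    finally have "ereal (B / A + A / B) \<le> tau t" .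
    with n have "B / A + A / B < n" by (metis le_less_trans less_ereal.simps(1))
    moreover have "0 < B / A" "0 < A / B" using AB by simp_all
    ultimately have "B / A \<le> n" "A / B \<le> n" by simp_all
    then show ?thesis using AB by (simp add: pos_divide_le_eq flip: A_def B_def)
  qed
  show thesis using * by (intro that[of "real n"]) auto
qed

text \<open>Starting at index 2^m ensures l \<le> k for every half-block length l = 2^q, the range
  covered by \<open>tau\<close>.\<close>

lemma tan_dyadic_slopes:
  fixes t :: "nat \<Rightarrow> real"
  assumes "0 < m" "0 \<le> T"
    and range: "\<And>k. 1 \<le> k \<Longrightarrow> 0 \<le> t k \<and> t k \<le> pi / 4"
    and dec: "\<And>i j. 1 \<le> i \<Longrightarrow> i < j \<Longrightarrow> t j < t i"
    and T: "\<And>k l. 1 \<le> l \<Longrightarrow> l \<le> k \<Longrightarrow> t k - t (k + l) \<le> T * (t (k + l) - t (k + 2 * l))"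
      "\<And>k l. 1 \<le> l \<Longrightarrow> l \<le> k \<Longrightarrow> t (k + l) - t (k + 2 * l) \<le> T * (t k - t (k + l))"
  shows "dyadic_slopes (\<lambda>j. tan (t (2 ^ m + j))) m (2 * T / (1 + 2 * T))"
proof
  let ?s = "\<lambda>j. tan (t (2 ^ m + j))" and ?\<theta> = "2 * T / (1 + 2 * T)"
  show "0 < m" "0 \<le> ?\<theta>" "?\<theta> < 1" using assms(1,2) by auto
  have tb: "t i - t j \<le> tan (t i) - tan (t j)" "tan (t i) - tan (t j) \<le> 2 * (t i - t j)"
    if "1 \<le> i" "i \<le> j" for i j
    using tan_diff_bounds[of "t j" "t i"] range that dec[of i j]
    by (metis le_trans less_imp_le nat_less_le order_refl)+
  have one: "1 \<le> 2 ^ m + i" for i :: nat by (simp add: Suc_leI)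
  show anti: "?s j \<le> ?s i" if "i \<le> j" for i j
    using tb(1)[OF one, of i "2 ^ m + j"] that dec[OF one, of i "2 ^ m + j"] by (cases "i = j") auto
  fix q p assume qp: "q < m" "(p::nat) < 2 ^ (m - q)"
  define p' where "p' = p div 2"
  define k where "k = 2 ^ m + p' * 2 ^ Suc q"
  define l :: nat where "l = 2 ^ q"
  have l1: "1 \<le> l" by (simp add: l_def)
  have "l \<le> 2 ^ m" using qp by (simp add: l_def)
  then have lk: "l \<le> k" by (simp add: k_def)
  have k1: "1 \<le> k" using l1 lk by simp
  define A B where "A = tan (t k) - tan (t (k + l))" and "B = tan (t (k + l)) - tan (t (k + 2 * l))"
  have comparable: "A \<le> 2 * (t k - t (k + l))" "B \<le> 2 * (t (k + l) - t (k + 2 * l))"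
    "t k - t (k + l) \<le> A" "t (k + l) - t (k + 2 * l) \<le> B"
    unfolding A_def B_def using k1 by (intro tb; simp)+
  have "t k - t (k + l) \<le> T * B"
    using T(1)[OF l1 lk] mult_left_mono[OF comparable(4) \<open>0 \<le> T\<close>] by linarith
  moreover have "t (k + l) - t (k + 2 * l) \<le> T * A"
    using T(2)[OF l1 lk] mult_left_mono[OF comparable(3) \<open>0 \<le> T\<close>] by linarith
  \<comment> \<open>The factor 2 is the distortion of the tangent. Adding 2 T A to A \<le> 2 T B
    gives (1 + 2T) A \<le> 2T (A + B), hence the value of \<theta>.\<close>
  ultimately have "A \<le> 2 * (T * B)" "B \<le> 2 * (T * A)"
    using comparable(1,2) by simp_all
  then have AB: "A \<le> ?\<theta> * (A + B)" "B \<le> ?\<theta> * (A + B)"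
    using \<open>0 \<le> T\<close> by (simp_all add: field_simps)
  have parent: "?s (p div 2 * 2 ^ Suc q) - ?s (Suc (p div 2) * 2 ^ Suc q) = A + B"
    by (simp add: A_def B_def k_def l_def p'_def algebra_simps)
  consider "p = 2 * p'" | "p = Suc (2 * p')" unfolding p'_def by linarith
  then have "?s (p * 2 ^ q) - ?s (Suc p * 2 ^ q) = A \<or> ?s (p * 2 ^ q) - ?s (Suc p * 2 ^ q) = B"
    by cases (simp_all add: A_def B_def k_def l_def algebra_simps)
  then show "?s (p * 2 ^ q) - ?s (Suc p * 2 ^ q) \<le> ?\<theta> * (?s (p div 2 * 2 ^ Suc q) - ?s (Suc (p div 2) * 2 ^ Suc q))"
    unfolding parent using AB by auto
qed

section \<open>Blow-up of the norm\<close>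

theorem theorem9:
  fixes t e :: "nat \<Rightarrow> real" and R :: "nat \<Rightarrow> (real^2) set" and \<mu>\<^sub>0 :: real
  assumes "\<And>k. k \<ge> 1 \<Longrightarrow> 0 \<le> t k \<and> t k \<le> pi / 4"
    and "\<And>k. k \<ge> 1 \<Longrightarrow> t (Suc k) < t k"
    and "t \<longlonglongrightarrow> 0"
    and "\<And>k. k \<ge> 1 \<Longrightarrow> 0 < e k \<and> e k \<le> 1"
    and "\<And>k. k \<ge> 1 \<Longrightarrow> rectangle_with_ecc_orient (R k) (e k) (t k)"
    and "tau t < \<infinity>"
    and "\<mu>\<^sub>0 > 0"
    and "\<And>k. k \<ge> 1 \<Longrightarrow> e k < \<mu>\<^sub>0 * \<bar>t k - t (Suc k)\<bar>"
  shows "bad_operator (R ` {1..})"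
  unfolding bad_operator_def
proof (intro allI impI)
  note range = assms(1) and lim = assms(3) and e = assms(4) and R = assms(5)
    and \<mu> = assms(7) and ecc = assms(8)
  fix p :: real assume p: "1 < p"
  have dec: "t j < t i" if "1 \<le> i" "i < j" for i j
    using that(2,1)
  proof (induction rule: strict_inc_induct)
    case (step i)
    then show ?case using less_trans[OF step.IH assms(2)] by simp
  qed (use assms(2) in simp)
  obtain T where T: "0 \<le> T"
    "\<And>k l. 1 \<le> l \<Longrightarrow> l \<le> k \<Longrightarrow> t k - t (k + l) \<le> T * (t (k + l) - t (k + 2 * l))"
    "\<And>k l. 1 \<le> l \<Longrightarrow> l \<le> k \<Longrightarrow> t (k + l) - t (k + 2 * l) \<le> T * (t k - t (k + l))"
    using tau_bounded[OF assms(6) dec] by blast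
  define \<theta> where "\<theta> = 2 * T / (1 + 2 * T)"
  have \<theta>: "0 \<le> \<theta>" "\<theta> < 1" using T(1) by (auto simp: \<theta>_def)
  \<comment> \<open>1 allows for the position of z inside its far tube, and 16
    \<open>\<mu>\<^sub>0\<close> for the thickness of the rectangle, at most 2 * 8 *
    \<open>e k\<close>.\<close>
  define M where "M = 1 + 16 * \<mu>\<^sub>0"
  have M: "0 < M" using \<mu> by (simp add: M_def)
  define \<epsilon> where "\<epsilon> m = M * \<theta> ^ (m div 2) + 4 / ((1 - \<theta>) * real m)" for m :: nat
  have "(\<lambda>m. M * \<theta> ^ (m div 2) + 4 / (1 - \<theta>) * inverse (real m)) \<longlonglongrightarrow> M * 0 + 4 / (1 - \<theta>) * 0"
  proof (intro tendsto_intros LIMSEQ_inverse_real_of_nat lim_inverse_n)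
    have "filterlim (\<lambda>m::nat. m div 2) sequentially sequentially"
      by (rule filterlim_at_top_div_const_nat) simp
    then show "(\<lambda>m. \<theta> ^ (m div 2)) \<longlonglongrightarrow> 0"
      by (rule filterlim_compose[OF LIMSEQ_realpow_zero[OF \<theta>]])
  qed
  then have \<epsilon>_lim: "\<epsilon> \<longlonglongrightarrow> 0"
    by (simp add: \<epsilon>_def[abs_def] divide_inverse mult.assoc)
  have big: "ennreal B \<le> maximal_norm (R ` {1..}) p" if "0 < B" for B :: real
  proof -
    \<comment> \<open>Solves (1/10) (1/\<delta>)^(1/p) = B.\<close>
    define \<delta> where "\<delta> = (10 * B) powr (- p)"
    have \<delta>: "0 < \<delta>" using \<open>0 < B\<close> by (simp add: \<delta>_def)
    obtain m0 where m0: "\<And>m. m0 \<le> m \<Longrightarrow> \<epsilon> m < \<delta>"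
      using order_tendstoD(2)[OF \<epsilon>_lim \<delta>] unfolding eventually_sequentially by blast
    \<comment> \<open>Makes the rectangle of length 8 at most 1 wide, as
      \<open>rectangle_average\<close> requires.\<close>
    obtain k0 where k0: "\<And>k. k0 \<le> k \<Longrightarrow> t k < 1 / (8 * \<mu>\<^sub>0)"
      using order_tendstoD(2)[OF lim, of "1 / (8 * \<mu>\<^sub>0)"] \<mu> unfolding eventually_sequentially by auto
    define m where "m = max m0 (max 2 k0)"
    have m: "\<epsilon> m < \<delta>" "2 \<le> m" "k0 \<le> m" using m0 by (auto simp: m_def)
    define N :: nat where "N = 2 ^ m"
    have N1: "1 \<le> N" by (simp add: N_def)
    have "k0 \<le> N" using m(3) less_exp[of m] unfolding N_def by linarith
    have small: "8 * e k \<le> 1" if "N \<le> k" for k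
    proof -
      have "0 \<le> t (Suc k)" "t (Suc k) < t k" using range dec N1 that by auto
      then have "e k < \<mu>\<^sub>0 * (t k - t (Suc k))" using ecc[of k] N1 that by simp
      also have "\<dots> \<le> \<mu>\<^sub>0 * t k" using \<mu> \<open>0 \<le> t (Suc k)\<close> by (intro mult_left_mono) auto
      also have "\<dots> \<le> \<mu>\<^sub>0 * (1 / (8 * \<mu>\<^sub>0))"
        using k0[of k] \<mu> \<open>k0 \<le> N\<close> that by (intro mult_left_mono) auto
      finally show ?thesis using \<mu> by simp
    qed
    define s where "s j = tan (t (N + j))" for j
    interpret dyadic_slopes s m \<theta>
      unfolding s_def[abs_def] \<theta>_def N_def
      using m(2) T range dec by (intro tan_dyadic_slopes) auto
    have gap: "t (N + j) - t (N + Suc j) \<le> s j - s (Suc j)" "0 < t (N + j) - t (N + Suc j)" for j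
      using tan_diff_bounds(1)[of "t (N + Suc j)" "t (N + j)"] range dec[of "N + j" "N + Suc j"] N1
      by (auto simp: s_def)
    have S: "0 < s 0 - s (2 ^ m)"
      using gap[of 0] antimono[of 1 "2 ^ m"] by simp
    define X where "X = near_tubes M"
    define a where "a = measure lebesgue X"
    have eX: "emeasure lebesgue X \<le> ennreal (\<epsilon> m * (s 0 - s (2 ^ m)))"
      using emeasure_near_tubes_le[of M] M m(2) by (simp add: X_def \<epsilon>_def)
    then have fin: "emeasure lebesgue X = ennreal a"
      unfolding a_def by (intro emeasure_eq_ennreal_measure) (auto simp: top_unique)
    have "0 < emeasure lebesgue X"
      unfolding X_def using gap[of 0] M by (intro emeasure_near_tubes_pos) auto
    then have a0: "0 < a" using fin by simp
    have \<epsilon>0: "0 \<le> \<epsilon> m" using M \<theta> by (simp add: \<epsilon>_def)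
    have "a \<le> \<epsilon> m * (s 0 - s (2 ^ m))"
      using eX fin S \<epsilon>0 by simp
    also have "\<dots> \<le> \<delta> * (s 0 - s (2 ^ m))"
      using m(1) S by (intro mult_right_mono) auto
    finally have ratio: "1 / \<delta> \<le> (s 0 - s (2 ^ m)) / a"
      using a0 \<delta> by (simp add: field_simps)
    have "B = 1 / 10 * (1 / \<delta>) powr (1 / p)"
      using \<open>0 < B\<close> p by (simp add: \<delta>_def powr_minus_divide powr_powr)
    also have "\<dots> \<le> 1 / 10 * ((s 0 - s (2 ^ m)) / a) powr (1 / p)"
      using ratio \<delta> p by (intro mult_left_mono powr_mono2) auto
    finally have "ennreal B \<le> ennreal (1 / 10 * ((s 0 - s (2 ^ m)) / a) powr (1 / p))"
      by (rule ennreal_leI)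
    also have "\<dots> \<le> maximal_norm (R ` {1..}) p"
    proof (rule maximal_norm_ge[OF _ fin a0 _ emeasure_far_tubes S])
      show "X \<in> sets lebesgue" "far_tubes \<in> sets lebesgue"
        unfolding X_def using near_tubes_borel far_tubes_borel by auto
      fix z assume "z \<in> far_tubes"
      then obtain j where j: "j < 2 ^ m" and z: "3 \<le> z$1" "z$1 \<le> 4"
        "icpt j - (s j - s (Suc j)) < z$2 - s j * z$1" "z$2 - s j * z$1 < icpt j"
        by (auto simp: far_tubes_def strip_def)
      define k where "k = N + j"
      have k1: "1 \<le> k" using N1 by (simp add: k_def)
      have sj: "s j = tan (t k)" by (simp add: s_def k_def)
      let ?\<eta> = "z$2 - tan (t k) * z$1"
      have be: "0 < 8 * e k" "8 * e k \<le> 1" using e[OF k1] small[of k] by (auto simp: k_def)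
      obtain c \<beta> where \<beta>: "0 < \<beta>" "\<beta> \<le> 2 * (8 * e k)" and zR: "z \<in> rectangle c (t k) 8 (8 * e k)"
        and sub: "strip (tan (t k)) {0..1} {?\<eta> - \<beta>..?\<eta>} \<subseteq> rectangle c (t k) 8 (8 * e k)"
        and av: "ennreal (1 / 10) \<le> emeasure lebesgue (strip (tan (t k)) {0..1} {?\<eta> - \<beta>..?\<eta>}) /
          emeasure lebesgue (rectangle c (t k) 8 (8 * e k))"
        using rectangle_average[OF _ _ be z(1,2)] range[OF k1] by metis
      have "e k \<le> \<mu>\<^sub>0 * (t k - t (Suc k))" using ecc[OF k1] gap(2)[of j] by (simp add: k_def)
      also have "\<dots> \<le> \<mu>\<^sub>0 * (s j - s (Suc j))" using \<mu> gap(1)[of j] by (simp add: k_def)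
      finally have "\<beta> \<le> 16 * \<mu>\<^sub>0 * (s j - s (Suc j))" using \<beta> by simp
      then have "s j - s (Suc j) + \<beta> \<le> M * (s j - s (Suc j))" by (simp add: M_def algebra_simps)
      \<comment> \<open>The line of slope s_j through z passes less than one width below line j, and
        the rectangle descends a further \<beta>.\<close>
      then have "strip (tan (t k)) {0..1} {?\<eta> - \<beta>..?\<eta>} \<subseteq> strip (s j) {0..1} {icpt j - M * (s j - s (Suc j))..icpt j}"
        using z unfolding strip_def sj by auto
      also have "\<dots> \<subseteq> X" unfolding X_def near_tubes_def using j by (intro UN_upper) simp
      finally have subX: "strip (tan (t k)) {0..1} {?\<eta> - \<beta>..?\<eta>} \<subseteq> X" .
      have "rectangle c (t k) 8 (8 * e k) \<in> dilates (R ` {1..})"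
        using R[OF k1] k1 by (intro rectangle_in_dilates) auto
      moreover have "strip (tan (t k)) {0..1} {?\<eta> - \<beta>..?\<eta>} \<in> sets lebesgue"
        using strip_borel by simp
      ultimately show "\<exists>Q\<in>dilates (R ` {1..}). \<exists>P\<in>sets lebesgue. z \<in> Q \<and> P \<subseteq> Q \<inter> X \<and>
          ennreal (1 / 10) \<le> emeasure lebesgue P / emeasure lebesgue Q"
        using zR sub subX av by blast
    qed (use p in auto)
    finally show ?thesis .
  qed
  show "maximal_norm (R ` {1..}) p = \<infinity>"
  proof (rule ccontr)
    assume "maximal_norm (R ` {1..}) p \<noteq> \<infinity>"
    then obtain r where r: "0 \<le> r" "maximal_norm (R ` {1..}) p = ennreal r"
      by (cases "maximal_norm (R ` {1..}) p") auto
    then show False using big[of "r + 1"] by simp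
  qed
qed

end
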